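(* Let $n\geq 2$ be an even number and let $A$ be a Banach algebra such that $\tilde{Z}^{\ell}_1(A^{(n)})=A^{(n)}$. If $A^{(n)}$ is weakly amenable, then $A^{(n-2)}$ is weakly amenable.
   Context: $A^{(n)}$ is the $n$-th dual of $A$ ($A^{(0)}=A$), with weak* topology $\sigma(A^{(n)},A^{(n-1)})$. For even $n\ge2$, $A^{(n)}=(A^{(n-2)})^{**}$ is a Banach algebra under the first Arens product built iteratively: for a Banach algebra $C$, the first Arens product on $C^{**}$ is $x''y''=w^*\text{-}\lim_\alpha w^*\text{-}\lim_\beta x_\alpha y_\beta$ where $(x_\alpha),(y_\beta)\subseteq C$ converge weak* to $x'',y''$. $\tilde{Z}^{\ell}_1(A^{(n)})=\{a\in A^{(n)}: b\mapsto ab,\ A^{(n)}\to A^{(n)},\ \text{is weak*-to-weak continuous}\}$. A Banach algebra $C$ is weakly amenable if every bounded derivation $D:C\to C^*$ is inner, i.e. $H^1(C,C^* )=\{0\}$, where $C^*$ is the dual $C$-bimodule. *)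

theory Defs
  imports "HOL-Analysis.Analysis"
begin

text \<open>
  Scalars are an arbitrary complete \<^typ>\<open>'k::real_normed_field\<close>; by Gelfand--Mazur this
  means exactly the real or the complex numbers, and both are instances.

  Since the iterated duals of a space have no common type, spaces are carrier sets with explicit
  operations.  Off the carrier the operations are irrelevant.
\<close>

record ('k, 'b) nspace =
  vcarrier :: "'b set"
  vzero :: 'b
  vadd :: "'b \<Rightarrow> 'b \<Rightarrow> 'b"
  vscale :: "'k \<Rightarrow> 'b \<Rightarrow> 'b"
  vnorm :: "'b \<Rightarrow> real"

definition vdist :: "('k::real_normed_field, 'b) nspace \<Rightarrow> 'b \<Rightarrow> 'b \<Rightarrow> real" where
  "vdist X x y =
     (if x \<in> vcarrier X \<and> y \<in> vcarrier X then vnorm X (vadd X x (vscale X (- 1) y)) else 0)"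

locale banach_space_on =
  fixes X :: "('k::{real_normed_field, banach}, 'b) nspace"
  assumes zero_closed: "vzero X \<in> vcarrier X"
    and add_closed: "\<lbrakk>x \<in> vcarrier X; y \<in> vcarrier X\<rbrakk> \<Longrightarrow> vadd X x y \<in> vcarrier X"
    and scale_closed: "x \<in> vcarrier X \<Longrightarrow> vscale X a x \<in> vcarrier X"
    and add_assoc: "\<lbrakk>x \<in> vcarrier X; y \<in> vcarrier X; z \<in> vcarrier X\<rbrakk>
      \<Longrightarrow> vadd X (vadd X x y) z = vadd X x (vadd X y z)"
    and add_commute: "\<lbrakk>x \<in> vcarrier X; y \<in> vcarrier X\<rbrakk> \<Longrightarrow> vadd X x y = vadd X y x"
    and add_zero: "x \<in> vcarrier X \<Longrightarrow> vadd X x (vzero X) = x"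
    and add_minus: "x \<in> vcarrier X \<Longrightarrow> vadd X x (vscale X (- 1) x) = vzero X"
    and scale_add_right: "\<lbrakk>x \<in> vcarrier X; y \<in> vcarrier X\<rbrakk>
      \<Longrightarrow> vscale X a (vadd X x y) = vadd X (vscale X a x) (vscale X a y)"
    and scale_add_left: "x \<in> vcarrier X
      \<Longrightarrow> vscale X (a + b) x = vadd X (vscale X a x) (vscale X b x)"
    and scale_scale: "x \<in> vcarrier X \<Longrightarrow> vscale X a (vscale X b x) = vscale X (a * b) x"
    and scale_one: "x \<in> vcarrier X \<Longrightarrow> vscale X 1 x = x"
    and norm_nonneg: "x \<in> vcarrier X \<Longrightarrow> 0 \<le> vnorm X x"
    and norm_eq_zero: "x \<in> vcarrier X \<Longrightarrow> vnorm X x = 0 \<longleftrightarrow> x = vzero X"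
    and norm_triangle: "\<lbrakk>x \<in> vcarrier X; y \<in> vcarrier X\<rbrakk>
      \<Longrightarrow> vnorm X (vadd X x y) \<le> vnorm X x + vnorm X y"
    and norm_scale: "x \<in> vcarrier X \<Longrightarrow> vnorm X (vscale X a x) = norm a * vnorm X x"
    and complete: "Metric_space.mcomplete (vcarrier X) (vdist X)"

locale banach_algebra_on = banach_space_on X
  for X :: "('k::{real_normed_field, banach}, 'b) nspace" +
  fixes mul :: "'b \<Rightarrow> 'b \<Rightarrow> 'b"
  assumes mul_closed: "\<lbrakk>x \<in> vcarrier X; y \<in> vcarrier X\<rbrakk> \<Longrightarrow> mul x y \<in> vcarrier X"
    and mul_assoc: "\<lbrakk>x \<in> vcarrier X; y \<in> vcarrier X; z \<in> vcarrier X\<rbrakk>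
      \<Longrightarrow> mul (mul x y) z = mul x (mul y z)"
    and mul_add_left: "\<lbrakk>x \<in> vcarrier X; y \<in> vcarrier X; z \<in> vcarrier X\<rbrakk>
      \<Longrightarrow> mul (vadd X x y) z = vadd X (mul x z) (mul y z)"
    and mul_add_right: "\<lbrakk>x \<in> vcarrier X; y \<in> vcarrier X; z \<in> vcarrier X\<rbrakk>
      \<Longrightarrow> mul x (vadd X y z) = vadd X (mul x y) (mul x z)"
    and mul_scale_left: "\<lbrakk>x \<in> vcarrier X; y \<in> vcarrier X\<rbrakk>
      \<Longrightarrow> mul (vscale X a x) y = vscale X a (mul x y)"
    and mul_scale_right: "\<lbrakk>x \<in> vcarrier X; y \<in> vcarrier X\<rbrakk>
      \<Longrightarrow> mul x (vscale X a y) = vscale X a (mul x y)"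
    and norm_mul: "\<lbrakk>x \<in> vcarrier X; y \<in> vcarrier X\<rbrakk>
      \<Longrightarrow> vnorm X (mul x y) \<le> vnorm X x * vnorm X y"

text \<open>Functionals are normalised to be \<^const>\<open>undefined\<close> off the carrier, so that equality of
  functionals is equality on the carrier.\<close>

definition bounded_functionals :: "('k::real_normed_field, 'b) nspace \<Rightarrow> ('b \<Rightarrow> 'k) set" where
  "bounded_functionals X = {f \<in> extensional (vcarrier X).
     (\<forall>x\<in>vcarrier X. \<forall>y\<in>vcarrier X. f (vadd X x y) = f x + f y) \<and>
     (\<forall>a. \<forall>x\<in>vcarrier X. f (vscale X a x) = a * f x) \<and>
     (\<exists>K. \<forall>x\<in>vcarrier X. norm (f x) \<le> K * vnorm X x)}"

definition dual_space :: "('k::real_normed_field, 'b) nspace \<Rightarrow> ('k, 'b \<Rightarrow> 'k) nspace" where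
  "dual_space X = \<lparr>
     vcarrier = bounded_functionals X,
     vzero = (\<lambda>x\<in>vcarrier X. 0),
     vadd = (\<lambda>f g. \<lambda>x\<in>vcarrier X. f x + g x),
     vscale = (\<lambda>a f. \<lambda>x\<in>vcarrier X. a * f x),
     vnorm = (\<lambda>f. SUP x\<in>{x \<in> vcarrier X. vnorm X x \<le> 1}. norm (f x))\<rparr>"

text \<open>
  The literal dual of a space over \<^typ>\<open>'b\<close> lives over \<^typ>\<open>'b \<Rightarrow> 'k\<close>, so an iteration with
  a variable number of steps cannot be written with literal duals.  Each dual is
  therefore copied back into \<^typ>\<open>'b\<close> along an encoding \<open>c\<close> of its functionals, with all
  operations and the norm transported; for \<open>c\<close> injective on the dual this is an isometric copy.
  Injectivity is an assumption on the encodings only; for any given \<open>n\<close> it can be met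
  for every Banach algebra, by first copying it into a large enough type \<^typ>\<open>'b\<close>.
\<close>

definition transport :: "('d \<Rightarrow> 'b) \<Rightarrow> ('k, 'd) nspace \<Rightarrow> ('k, 'b) nspace" where
  "transport c Y = (let d = inv_into (vcarrier Y) c in \<lparr>
     vcarrier = c ` vcarrier Y,
     vzero = c (vzero Y),
     vadd = (\<lambda>u v. c (vadd Y (d u) (d v))),
     vscale = (\<lambda>a u. c (vscale Y a (d u))),
     vnorm = (\<lambda>u. vnorm Y (d u))\<rparr>)"

definition coded_dual ::
  "('k::real_normed_field, 'b) nspace \<Rightarrow> (('b \<Rightarrow> 'k) \<Rightarrow> 'b) \<Rightarrow> ('k, 'b) nspace" where
  "coded_dual X c = transport c (dual_space X)"

definition pairing ::
  "('k::real_normed_field, 'b) nspace \<Rightarrow> (('b \<Rightarrow> 'k) \<Rightarrow> 'b) \<Rightarrow> 'b \<Rightarrow> 'b \<Rightarrow> 'k" where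
  "pairing X c f x = inv_into (bounded_functionals X) c f x"

text \<open>The iterated dual \<open>A\<^sup>(\<^sup>n\<^sup>)\<close>; \<open>c k\<close> encodes the functionals on \<open>A\<^sup>(\<^sup>k\<^sup>)\<close>.\<close>

primrec iter_dual ::
  "('k::real_normed_field, 'b) nspace \<Rightarrow> (nat \<Rightarrow> ('b \<Rightarrow> 'k) \<Rightarrow> 'b) \<Rightarrow> nat \<Rightarrow> ('k, 'b) nspace" where
  "iter_dual X c 0 = X"
| "iter_dual X c (Suc k) = coded_dual (iter_dual X c k) (c k)"

definition initial_topology :: "'b set \<Rightarrow> ('b \<Rightarrow> 'k::topological_space) set \<Rightarrow> 'b topology" where
  "initial_topology S \<Phi> =
     topology_generated_by {{x \<in> S. \<phi> x \<in> U} |\<phi> U. \<phi> \<in> \<Phi> \<and> open U}"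

definition weak_topology :: "('k::real_normed_field, 'b) nspace \<Rightarrow> 'b topology" where
  "weak_topology X = initial_topology (vcarrier X) (bounded_functionals X)"

text \<open>The topology \<open>\<sigma>(X\<^sup>*, X)\<close> on \<open>coded_dual X c\<close>.\<close>

definition weak_star_topology ::
  "('k::real_normed_field, 'b) nspace \<Rightarrow> (('b \<Rightarrow> 'k) \<Rightarrow> 'b) \<Rightarrow> 'b topology" where
  "weak_star_topology X c =
     initial_topology (vcarrier (coded_dual X c)) ((\<lambda>x f. pairing X c f x) ` vcarrier X)"

definition canonical_embedding ::
  "('k::real_normed_field, 'b) nspace \<Rightarrow> (('b \<Rightarrow> 'k) \<Rightarrow> 'b) \<Rightarrow> (('b \<Rightarrow> 'k) \<Rightarrow> 'b) \<Rightarrow> 'b \<Rightarrow> 'b" where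
  "canonical_embedding X c c' x = c' (\<lambda>f\<in>vcarrier (coded_dual X c). pairing X c f x)"

text \<open>
  The first Arens product on the bidual of \<open>(X, mul)\<close>, where \<open>c\<close> and \<open>c'\<close> encode the dual and the
  bidual.  A net in \<open>X\<close> enters only through its image filter, so nets are rendered as proper filters
  on the carrier of \<open>X\<close>; \<open>l x\<close> is the inner limit of \<open>x y\<^sub>\<beta>\<close> over \<open>\<beta>\<close>.
\<close>

definition first_arens_product ::
  "('k::real_normed_field, 'b) nspace \<Rightarrow> ('b \<Rightarrow> 'b \<Rightarrow> 'b) \<Rightarrow>
   (('b \<Rightarrow> 'k) \<Rightarrow> 'b) \<Rightarrow> (('b \<Rightarrow> 'k) \<Rightarrow> 'b) \<Rightarrow> 'b \<Rightarrow> 'b \<Rightarrow> 'b" where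
  "first_arens_product X mul c c' u v =
     (let T = weak_star_topology (coded_dual X c) c'; \<iota> = canonical_embedding X c c' in
      THE w. \<forall>F G.
        F \<noteq> bot \<and> F \<le> principal (vcarrier X) \<and> limitin T \<iota> u F \<and>
        G \<noteq> bot \<and> G \<le> principal (vcarrier X) \<and> limitin T \<iota> v G \<longrightarrow>
        (\<exists>l. (\<forall>x\<in>vcarrier X. limitin T (\<lambda>y. \<iota> (mul x y)) (l x) G) \<and> limitin T l w F))"

text \<open>The product on \<open>A\<^sup>(\<^sup>n\<^sup>)\<close> for even \<open>n\<close>; at odd \<open>n\<close> it is meaningless.\<close>

fun iter_arens ::
  "('k::real_normed_field, 'b) nspace \<Rightarrow> ('b \<Rightarrow> 'b \<Rightarrow> 'b) \<Rightarrow> (nat \<Rightarrow> ('b \<Rightarrow> 'k) \<Rightarrow> 'b) \<Rightarrow>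
   nat \<Rightarrow> 'b \<Rightarrow> 'b \<Rightarrow> 'b" where
  "iter_arens X mul c 0 = mul"
| "iter_arens X mul c (Suc 0) = undefined"
| "iter_arens X mul c (Suc (Suc k)) =
     first_arens_product (iter_dual X c k) (iter_arens X mul c k) (c k) (c (Suc k))"

text \<open>Meaningful for even \<open>n \<ge> 2\<close>, where \<open>A\<^sup>(\<^sup>n\<^sup>)\<close> is the coded dual of \<open>A\<^sup>(\<^sup>n\<^sup>-\<^sup>1\<^sup>)\<close>.\<close>

definition Z1_tilde_left ::
  "('k::real_normed_field, 'b) nspace \<Rightarrow> ('b \<Rightarrow> 'b \<Rightarrow> 'b) \<Rightarrow> (nat \<Rightarrow> ('b \<Rightarrow> 'k) \<Rightarrow> 'b) \<Rightarrow>
   nat \<Rightarrow> 'b set" where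
  "Z1_tilde_left X mul c n = {a \<in> vcarrier (iter_dual X c n).
     continuous_map (weak_star_topology (iter_dual X c (n - 1)) (c (n - 1)))
       (weak_topology (iter_dual X c n)) (\<lambda>b. iter_arens X mul c n a b)}"

definition left_action ::
  "('k, 'b) nspace \<Rightarrow> ('b \<Rightarrow> 'b \<Rightarrow> 'b) \<Rightarrow> 'b \<Rightarrow> ('b \<Rightarrow> 'k) \<Rightarrow> 'b \<Rightarrow> 'k" where
  "left_action X mul a f = (\<lambda>b\<in>vcarrier X. f (mul b a))"

definition right_action ::
  "('k, 'b) nspace \<Rightarrow> ('b \<Rightarrow> 'b \<Rightarrow> 'b) \<Rightarrow> ('b \<Rightarrow> 'k) \<Rightarrow> 'b \<Rightarrow> 'b \<Rightarrow> 'k" where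
  "right_action X mul f a = (\<lambda>b\<in>vcarrier X. f (mul a b))"

definition bounded_derivation ::
  "('k::real_normed_field, 'b) nspace \<Rightarrow> ('b \<Rightarrow> 'b \<Rightarrow> 'b) \<Rightarrow> ('b \<Rightarrow> 'b \<Rightarrow> 'k) \<Rightarrow> bool" where
  "bounded_derivation X mul D \<longleftrightarrow>
     (let X' = dual_space X in
      (\<forall>x\<in>vcarrier X. D x \<in> vcarrier X') \<and>
      (\<forall>x\<in>vcarrier X. \<forall>y\<in>vcarrier X. D (vadd X x y) = vadd X' (D x) (D y)) \<and>
      (\<forall>a. \<forall>x\<in>vcarrier X. D (vscale X a x) = vscale X' a (D x)) \<and>
      (\<exists>K. \<forall>x\<in>vcarrier X. vnorm X' (D x) \<le> K * vnorm X x) \<and>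
      (\<forall>x\<in>vcarrier X. \<forall>y\<in>vcarrier X.
         D (mul x y) = vadd X' (right_action X mul (D x) y) (left_action X mul x (D y))))"

definition inner_derivation ::
  "('k::real_normed_field, 'b) nspace \<Rightarrow> ('b \<Rightarrow> 'b \<Rightarrow> 'b) \<Rightarrow> ('b \<Rightarrow> 'b \<Rightarrow> 'k) \<Rightarrow> bool" where
  "inner_derivation X mul D \<longleftrightarrow>
     (let X' = dual_space X in
      \<exists>\<phi>\<in>vcarrier X'. \<forall>x\<in>vcarrier X.
        D x = vadd X' (left_action X mul x \<phi>) (vscale X' (- 1) (right_action X mul \<phi> x)))"

definition weakly_amenable ::
  "('k::real_normed_field, 'b) nspace \<Rightarrow> ('b \<Rightarrow> 'b \<Rightarrow> 'b) \<Rightarrow> bool" where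
  "weakly_amenable X mul \<longleftrightarrow> (\<forall>D. bounded_derivation X mul D \<longrightarrow> inner_derivation X mul D)"

end

theory Submission
  imports Defs
begin

text \<open>
  Let \<open>B = A\<^sup>(\<^sup>n\<^sup>-\<^sup>2\<^sup>)\<close>, and let \<open>D : B \<rightarrow> B\<^sup>*\<close> be a bounded derivation with second adjoint
  \<open>D'' : B\<^sup>*\<^sup>* \<rightarrow> B\<^sup>*\<^sup>*\<^sup>*\<close>.  For a net \<open>a\<^sub>\<alpha>\<close> in \<open>B\<close> converging weak* to \<open>u\<close>, evaluating \<open>D'' (u v)\<close> at \<open>w\<close>
  yields \<open>D'' u (v w) + lim\<^sub>\<alpha> D'' v (w a\<^sub>\<alpha>)\<close>.  Left multiplication by \<open>w\<close> is weak*-to-weak continuous,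
  so the limit is \<open>D'' v (w u)\<close> and \<open>D''\<close> is a derivation.  It is therefore implemented by some
  \<open>\<phi> \<in> B\<^sup>*\<^sup>*\<^sup>*\<close>, and the restriction of \<open>\<phi>\<close> to \<open>B\<close> implements \<open>D\<close>.
\<close>

section \<open>Duals of carrier-based spaces\<close>

text \<open>
  Deliberately weak: everything required here has to be re-proved for each iterated dual.
\<close>

locale prenormed_space_on =
  fixes X :: "('k::{real_normed_field, banach}, 'b) nspace"
  assumes zero_closed: "vzero X \<in> vcarrier X"
    and add_closed: "\<lbrakk>x \<in> vcarrier X; y \<in> vcarrier X\<rbrakk> \<Longrightarrow> vadd X x y \<in> vcarrier X"
    and scale_closed: "x \<in> vcarrier X \<Longrightarrow> vscale X a x \<in> vcarrier X"
    and norm_nonneg: "x \<in> vcarrier X \<Longrightarrow> 0 \<le> vnorm X x"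
    and norm_zero: "vnorm X (vzero X) = 0"
    and norm_scale: "x \<in> vcarrier X \<Longrightarrow> vnorm X (vscale X a x) = norm a * vnorm X x"

lemma bounded_functionalsI:
  assumes "f \<in> extensional (vcarrier X)"
    and "\<And>x y. \<lbrakk>x \<in> vcarrier X; y \<in> vcarrier X\<rbrakk> \<Longrightarrow> f (vadd X x y) = f x + f y"
    and "\<And>a x. x \<in> vcarrier X \<Longrightarrow> f (vscale X a x) = a * f x"
    and "\<And>x. x \<in> vcarrier X \<Longrightarrow> norm (f x) \<le> K * vnorm X x"
  shows "f \<in> bounded_functionals X"
  using assms unfolding bounded_functionals_def by blast

lemma functional_extensional: "f \<in> bounded_functionals X \<Longrightarrow> f \<in> extensional (vcarrier X)"
  by (simp add: bounded_functionals_def)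

lemma functional_add:
  "\<lbrakk>f \<in> bounded_functionals X; x \<in> vcarrier X; y \<in> vcarrier X\<rbrakk> \<Longrightarrow> f (vadd X x y) = f x + f y"
  by (simp add: bounded_functionals_def)

lemma functional_scale:
  "\<lbrakk>f \<in> bounded_functionals X; x \<in> vcarrier X\<rbrakk> \<Longrightarrow> f (vscale X a x) = a * f x"
  by (simp add: bounded_functionals_def)

lemma functional_eqI:
  assumes "f \<in> bounded_functionals X" "g \<in> bounded_functionals X"
    and "\<And>x. x \<in> vcarrier X \<Longrightarrow> f x = g x"
  shows "f = g"
  using assms by (meson extensionalityI functional_extensional)

lemma vcarrier_dual [simp]: "vcarrier (dual_space X) = bounded_functionals X"
  and vadd_dual: "vadd (dual_space X) f g = (\<lambda>x\<in>vcarrier X. f x + g x)"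
  and vscale_dual: "vscale (dual_space X) a f = (\<lambda>x\<in>vcarrier X. a * f x)"
  and vzero_dual: "vzero (dual_space X) = (\<lambda>x\<in>vcarrier X. 0)"
  and vnorm_dual:
    "vnorm (dual_space X) f = (SUP x\<in>{x \<in> vcarrier X. vnorm X x \<le> 1}. norm (f x))"
  by (simp_all add: dual_space_def)

context prenormed_space_on
begin

lemma dual_norm_bdd:
  assumes "f \<in> bounded_functionals X"
  shows "bdd_above ((\<lambda>x. norm (f x)) ` {x \<in> vcarrier X. vnorm X x \<le> 1})"
proof -
  obtain K where K: "\<And>x. x \<in> vcarrier X \<Longrightarrow> norm (f x) \<le> K * vnorm X x"
    using assms unfolding bounded_functionals_def by blast
  have "norm (f x) \<le> \<bar>K\<bar>" if "x \<in> vcarrier X" "vnorm X x \<le> 1" for x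
  proof -
    have "K * vnorm X x \<le> \<bar>K\<bar> * vnorm X x"
      using norm_nonneg[OF that(1)] by (intro mult_right_mono) auto
    also have "\<dots> \<le> \<bar>K\<bar> * 1" using that(2) by (intro mult_left_mono) auto
    finally show ?thesis using K[OF that(1)] by simp
  qed
  then show ?thesis by (auto intro!: bdd_aboveI)
qed

text \<open>The zero vector lies in the unit ball, so the supremum is taken over a nonempty set and
  dominates at least one norm.\<close>

lemma dual_norm_nonneg:
  assumes "f \<in> bounded_functionals X"
  shows "0 \<le> vnorm (dual_space X) f"
proof -
  have "norm (f (vzero X)) \<le> vnorm (dual_space X) f"
    unfolding vnorm_dual using dual_norm_bdd[OF assms] zero_closed norm_zero
    by (intro cSUP_upper) auto
  then show ?thesis using norm_ge_zero order_trans by blast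
qed

lemma functional_bound:
  assumes f: "f \<in> bounded_functionals X" and x: "x \<in> vcarrier X"
  shows "norm (f x) \<le> vnorm (dual_space X) f * vnorm X x"
proof (cases "vnorm X x = 0")
  case True
  \<comment> \<open>The norm need not be definite, so \<open>x\<close> may differ from
    \<open>vzero X\<close> here; the bound \<open>K * vnorm X x\<close> still forces
    \<open>f x = 0\<close>.\<close>
  then show ?thesis using f x by (force simp: bounded_functionals_def)
next
  case False
  then have pos: "0 < vnorm X x" using norm_nonneg[OF x] by simp
  let ?y = "vscale X (of_real (inverse (vnorm X x))) x"
  have "vnorm X ?y = 1" using pos by (simp add: norm_scale[OF x] del: of_real_inverse)
  then have "norm (f ?y) \<le> vnorm (dual_space X) f"
    unfolding vnorm_dual using dual_norm_bdd[OF f] scale_closed[OF x]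
    by (intro cSUP_upper) auto
  then have "inverse (vnorm X x) * norm (f x) \<le> vnorm (dual_space X) f"
    using pos by (simp add: functional_scale[OF f x] norm_mult norm_inverse)
  then show ?thesis using pos by (simp add: field_simps)
qed

lemma dual_norm_le:
  assumes "0 \<le> K" "\<And>x. x \<in> vcarrier X \<Longrightarrow> norm (f x) \<le> K * vnorm X x"
  shows "vnorm (dual_space X) f \<le> K"
  unfolding vnorm_dual
proof (rule cSUP_least)
  show "{x \<in> vcarrier X. vnorm X x \<le> 1} \<noteq> {}" using zero_closed norm_zero by auto
  fix x assume "x \<in> {x \<in> vcarrier X. vnorm X x \<le> 1}"
  then show "norm (f x) \<le> K"
    using assms(1) assms(2)[of x] mult_left_mono[of "vnorm X x" 1 K] by auto
qed

lemma prenormed_dual: "prenormed_space_on (dual_space X)"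
proof
  show zero: "vzero (dual_space X) \<in> vcarrier (dual_space X)"
    unfolding vcarrier_dual
    by (rule bounded_functionalsI[where K=0]) (auto simp: vzero_dual add_closed scale_closed)
  have "vnorm (dual_space X) (vzero (dual_space X)) \<le> 0"
    by (rule dual_norm_le) (auto simp: vzero_dual)
  moreover have "0 \<le> vnorm (dual_space X) (vzero (dual_space X))"
    using dual_norm_nonneg zero by simp
  ultimately show "vnorm (dual_space X) (vzero (dual_space X)) = 0" by simp
next
  fix f g assume "f \<in> vcarrier (dual_space X)" "g \<in> vcarrier (dual_space X)"
  then have f: "f \<in> bounded_functionals X" and g: "g \<in> bounded_functionals X" by simp_all
  show "vadd (dual_space X) f g \<in> vcarrier (dual_space X)"
    unfolding vcarrier_dual
  proof (rule bounded_functionalsI[where K="vnorm (dual_space X) f + vnorm (dual_space X) g"])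
    fix x assume x: "x \<in> vcarrier X"
    have "norm (f x + g x) \<le> norm (f x) + norm (g x)" by (rule norm_triangle_ineq)
    then show "norm (vadd (dual_space X) f g x)
      \<le> (vnorm (dual_space X) f + vnorm (dual_space X) g) * vnorm X x"
      using functional_bound[OF f x] functional_bound[OF g x] x
      by (simp add: vadd_dual distrib_right)
  qed (auto simp: vadd_dual add_closed scale_closed functional_add[OF f] functional_add[OF g]
      functional_scale[OF f] functional_scale[OF g] distrib_left)
next
  fix f and a :: 'k
  assume "f \<in> vcarrier (dual_space X)"
  then have f: "f \<in> bounded_functionals X" by simp
  have bound: "norm (vscale (dual_space X) a f x) \<le> norm a * vnorm (dual_space X) f * vnorm X x"
    if "x \<in> vcarrier X" for x
    using functional_bound[OF f that] that
    by (simp add: vscale_dual norm_mult mult.assoc mult_left_mono)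
  show mem: "vscale (dual_space X) a f \<in> vcarrier (dual_space X)"
    unfolding vcarrier_dual
  proof (rule bounded_functionalsI[where K="norm a * vnorm (dual_space X) f"])
    show "norm (vscale (dual_space X) a f x) \<le> norm a * vnorm (dual_space X) f * vnorm X x"
      if "x \<in> vcarrier X" for x
      using that by (rule bound)
  qed (simp_all add: vscale_dual add_closed scale_closed functional_add[OF f]
      functional_scale[OF f] distrib_left)
  show "0 \<le> vnorm (dual_space X) f" by (rule dual_norm_nonneg[OF f])
  show "vnorm (dual_space X) (vscale (dual_space X) a f) = norm a * vnorm (dual_space X) f"
  proof (rule antisym)
    show "vnorm (dual_space X) (vscale (dual_space X) a f) \<le> norm a * vnorm (dual_space X) f"
      by (rule dual_norm_le[OF _ bound]) (auto simp: dual_norm_nonneg[OF f])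
    show "norm a * vnorm (dual_space X) f \<le> vnorm (dual_space X) (vscale (dual_space X) a f)"
    proof (cases "a = 0")
      case True
      then show ?thesis using dual_norm_nonneg mem by simp
    next
      case False
      \<comment> \<open>For the reverse inequality, a bound for \<open>a f\<close> divided by
        \<open>norm a\<close> is a bound for \<open>f\<close>.\<close>
      have "vnorm (dual_space X) f \<le> vnorm (dual_space X) (vscale (dual_space X) a f) / norm a"
      proof (rule dual_norm_le)
        show "0 \<le> vnorm (dual_space X) (vscale (dual_space X) a f) / norm a"
          using dual_norm_nonneg mem by simp
        fix x assume x: "x \<in> vcarrier X"
        have "norm (vscale (dual_space X) a f x)
            \<le> vnorm (dual_space X) (vscale (dual_space X) a f) * vnorm X x"
          using functional_bound[OF _ x] mem by simp
        then show "norm (f x)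
            \<le> vnorm (dual_space X) (vscale (dual_space X) a f) / norm a * vnorm X x"
          using x False by (simp add: vscale_dual norm_mult field_simps)
      qed
      then show ?thesis using False by (simp add: field_simps)
    qed
  qed
qed

end

section \<open>Coded duals and their pairing\<close>

locale coded_dual_on = prenormed_space_on X
  for X :: "('k::{real_normed_field, banach}, 'b) nspace" +
  fixes c :: "('b \<Rightarrow> 'k) \<Rightarrow> 'b"
  assumes inj_c: "inj_on c (bounded_functionals X)"
begin

abbreviation "X' \<equiv> coded_dual X c"
abbreviation "pair \<equiv> pairing X c"

lemma pair_code [simp]: "\<phi> \<in> bounded_functionals X \<Longrightarrow> pair (c \<phi>) = \<phi>"
  unfolding pairing_def using inj_c by (simp add: fun_eq_iff)

lemma vcarrier_coded: "vcarrier X' = c ` bounded_functionals X"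
  by (simp add: coded_dual_def transport_def Let_def)

lemma code_closed [simp]: "\<phi> \<in> bounded_functionals X \<Longrightarrow> c \<phi> \<in> vcarrier X'"
  by (simp add: vcarrier_coded)

lemma pair_functional [simp]: "f \<in> vcarrier X' \<Longrightarrow> pair f \<in> bounded_functionals X"
  by (auto simp: vcarrier_coded)

text \<open>Elements of \<open>X'\<close> are codes of functionals that are extensional on the
  carrier, so evaluation separates them. Most identities in coded duals below are checked in this
  way.\<close>

lemma coded_eqI:
  assumes "f \<in> vcarrier X'" "g \<in> vcarrier X'" "\<And>x. x \<in> vcarrier X \<Longrightarrow> pair f x = pair g x"
  shows "f = g"
proof -
  have "pair f = pair g" using assms by (intro functional_eqI) auto
  then show ?thesis using assms(1,2) by (auto simp: vcarrier_coded)
qed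

lemma vadd_coded: "vadd X' f g = c (vadd (dual_space X) (pair f) (pair g))"
  and vscale_coded: "vscale X' a f = c (vscale (dual_space X) a (pair f))"
  and vzero_coded: "vzero X' = c (vzero (dual_space X))"
  and vnorm_coded: "vnorm X' f = vnorm (dual_space X) (pair f)"
  by (simp_all add: coded_dual_def transport_def Let_def pairing_def[abs_def])

sublocale dual: prenormed_space_on "dual_space X"
  by (rule prenormed_dual)

text \<open>The coded dual satisfies the axioms imposed on \<open>X\<close>, so the construction can
  be applied to it again.\<close>

sublocale coded: prenormed_space_on X'
  by unfold_locales
    (use dual.zero_closed dual.add_closed dual.scale_closed dual.norm_nonneg dual.norm_zero
      dual.norm_scale in \<open>auto simp: vadd_coded vscale_coded vzero_coded vnorm_coded\<close>)

lemma pair_vadd: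
  "\<lbrakk>f \<in> vcarrier X'; g \<in> vcarrier X'; x \<in> vcarrier X\<rbrakk>
    \<Longrightarrow> pair (vadd X' f g) x = pair f x + pair g x"
  using dual.add_closed[of "pair f" "pair g"] by (simp add: vadd_coded) (simp add: vadd_dual)

lemma pair_vscale:
  "\<lbrakk>f \<in> vcarrier X'; x \<in> vcarrier X\<rbrakk> \<Longrightarrow> pair (vscale X' a f) x = a * pair f x"
  using dual.scale_closed[of "pair f" a] by (simp add: vscale_coded) (simp add: vscale_dual)

lemma pair_bound:
  "\<lbrakk>f \<in> vcarrier X'; x \<in> vcarrier X\<rbrakk> \<Longrightarrow> norm (pair f x) \<le> vnorm X' f * vnorm X x"
  by (simp add: vnorm_coded functional_bound)

lemma pair_add_right:
  "\<lbrakk>f \<in> vcarrier X'; x \<in> vcarrier X; y \<in> vcarrier X\<rbrakk>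
    \<Longrightarrow> pair f (vadd X x y) = pair f x + pair f y"
  by (simp add: functional_add)

lemma pair_scale_right:
  "\<lbrakk>f \<in> vcarrier X'; x \<in> vcarrier X\<rbrakk> \<Longrightarrow> pair f (vscale X a x) = a * pair f x"
  by (simp add: functional_scale)

lemma coded_norm_le:
  assumes "0 \<le> K" "\<And>x. x \<in> vcarrier X \<Longrightarrow> norm (pair f x) \<le> K * vnorm X x"
  shows "vnorm X' f \<le> K"
  unfolding vnorm_coded using assms by (rule dual_norm_le)

text \<open>The common way of defining elements of a coded dual: the module actions, the Arens
  product and the adjoint of a derivation are all codes of such restrictions.\<close>

lemma code_restrict:
  assumes "\<And>x y. \<lbrakk>x \<in> vcarrier X; y \<in> vcarrier X\<rbrakk> \<Longrightarrow> g (vadd X x y) = g x + g y"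
    and "\<And>a x. x \<in> vcarrier X \<Longrightarrow> g (vscale X a x) = a * g x"
    and "\<And>x. x \<in> vcarrier X \<Longrightarrow> norm (g x) \<le> K * vnorm X x"
  shows code_restrict_closed: "c (restrict g (vcarrier X)) \<in> vcarrier X'"
    and pair_code_restrict: "x \<in> vcarrier X \<Longrightarrow> pair (c (restrict g (vcarrier X))) x = g x"
proof -
  have "restrict g (vcarrier X) \<in> bounded_functionals X"
    by (rule bounded_functionalsI[where K=K]) (use assms in \<open>auto simp: add_closed scale_closed\<close>)
  then show "c (restrict g (vcarrier X)) \<in> vcarrier X'"
    and "x \<in> vcarrier X \<Longrightarrow> pair (c (restrict g (vcarrier X))) x = g x"
    by simp_all
qed

section \<open>Weak* density of a space in its bidual\<close>

text \<open>
  Density without the norm bound of Goldstine's theorem is finite-dimensional linear algebra, so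
  Hahn--Banach is avoided.
\<close>

lemma vanish_on_common_kernel:
  assumes "finite S" "S \<subseteq> vcarrier X'" "g \<in> vcarrier X'"
    and "\<And>x. \<lbrakk>x \<in> vcarrier X; \<forall>f\<in>S. pair f x = 0\<rbrakk> \<Longrightarrow> pair g x = 0"
    and add: "\<And>f h. \<lbrakk>f \<in> vcarrier X'; h \<in> vcarrier X'\<rbrakk> \<Longrightarrow> \<Psi> (vadd X' f h) = \<Psi> f + \<Psi> h"
    and scale: "\<And>a f. f \<in> vcarrier X' \<Longrightarrow> \<Psi> (vscale X' a f) = a * \<Psi> f"
    and "\<And>f. f \<in> S \<Longrightarrow> \<Psi> f = (0::'k)"
  shows "\<Psi> g = 0"
  using assms(1-4,7)
proof (induction S arbitrary: g rule: finite_induct)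
  case empty
  \<comment> \<open>With no constraints \<open>g\<close> vanishes on the whole carrier, hence equals
    its multiple by 0, and homogeneity of \<open>\<Psi>\<close> gives the value 0.\<close>
  then have "vscale X' 0 g = g"
    by (intro coded_eqI) (auto simp: coded.scale_closed pair_vscale)
  then show ?case using scale[OF empty(2), of 0] by simp
next
  case (insert h S)
  have h: "h \<in> vcarrier X'" using insert by auto
  note g = insert.prems(2)
  show ?case
  proof (cases "\<exists>z\<in>vcarrier X. (\<forall>f\<in>S. pair f z = 0) \<and> pair h z \<noteq> 0")
    \<comment> \<open>Here \<open>h\<close> already vanishes on the common kernel of
      \<open>S\<close>, so the induction hypothesis applies to \<open>g\<close> itself.\<close>
    case False
    show ?thesis
    proof (rule insert.IH)
      show "pair g x = 0" if "x \<in> vcarrier X" "\<forall>f\<in>S. pair f x = 0" for x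
        using False that insert.prems(3)[of x] by blast
    qed (use insert.prems in auto)
  next
    case True
    then obtain z where z: "z \<in> vcarrier X" "\<And>f. f \<in> S \<Longrightarrow> pair f z = 0" "pair h z \<noteq> 0"
      by blast
    \<comment> \<open>The scalar for which \<open>g - t h\<close> vanishes at
      \<open>z\<close>.\<close>
    define t where "t = pair g z / pair h z"
    define g' where "g' = vadd X' g (vscale X' (- t) h)"
    have g': "g' \<in> vcarrier X'" by (simp add: g'_def g h coded.add_closed coded.scale_closed)
    have "\<Psi> g' = 0"
    proof (rule insert.IH)
      fix x assume x: "x \<in> vcarrier X" and ker: "\<forall>f\<in>S. pair f x = 0"
      \<comment> \<open>Shifting \<open>x\<close> along \<open>z\<close> reaches the kernel of
        \<open>h\<close> without leaving the kernel of \<open>S\<close>; moreover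
        \<open>pair g y\<close> equals \<open>pair g' x\<close>.\<close>
      define y where "y = vadd X x (vscale X (- (pair h x / pair h z)) z)"
      have y: "y \<in> vcarrier X" by (simp add: y_def x z(1) add_closed scale_closed)
      have pair_y: "pair f y = pair f x - pair h x / pair h z * pair f z"
        if "f \<in> vcarrier X'" for f
        using that x z(1) by (simp add: y_def pair_add_right pair_scale_right scale_closed)
      have "pair f y = 0" if "f \<in> insert h S" for f
        using that insert.prems(1) ker z pair_y[of f] by auto
      then have "pair g y = 0" using insert.prems(3) y by blast
      then show "pair g' x = 0"
        using x by (simp add: pair_y[OF g] g'_def t_def pair_vadd pair_vscale g h
            coded.scale_closed mult.commute)
    qed (use insert.prems g' in auto)
    then show ?thesis
      using insert.prems(4)[of h] by (simp add: g'_def add scale g h coded.scale_closed)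
  qed
qed

text \<open>Functionals are adjoined one by one. Either some direction \<open>z\<close> is invisible
  to the earlier functionals but not to the new one, and moving along it corrects the value, or the
  new functional depends on the earlier ones and its value is already right.\<close>

lemma finite_interpolation:
  assumes "finite S" "S \<subseteq> vcarrier X'"
    and add: "\<And>f h. \<lbrakk>f \<in> vcarrier X'; h \<in> vcarrier X'\<rbrakk> \<Longrightarrow> \<Phi> (vadd X' f h) = \<Phi> f + \<Phi> h"
    and scale: "\<And>a f. f \<in> vcarrier X' \<Longrightarrow> \<Phi> (vscale X' a f) = a * \<Phi> f"
  shows "\<exists>x\<in>vcarrier X. \<forall>f\<in>S. pair f x = (\<Phi> f :: 'k)"
  using assms(1,2)
proof (induction S rule: finite_induct)
  case empty
  then show ?case using zero_closed by auto
next
  case (insert g S)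
  have g: "g \<in> vcarrier X'" using insert by auto
  obtain x where x: "x \<in> vcarrier X" "\<And>f. f \<in> S \<Longrightarrow> pair f x = \<Phi> f"
    using insert by auto
  show ?case
  proof (cases "\<exists>z\<in>vcarrier X. (\<forall>f\<in>S. pair f z = 0) \<and> pair g z \<noteq> 0")
    case True
    then obtain z where z: "z \<in> vcarrier X" "\<And>f. f \<in> S \<Longrightarrow> pair f z = 0" "pair g z \<noteq> 0"
      by blast
    let ?y = "vadd X x (vscale X ((\<Phi> g - pair g x) / pair g z) z)"
    have "pair f ?y = \<Phi> f" if "f \<in> insert g S" for f
      using that insert.prems x z
      by (auto simp: pair_add_right pair_scale_right scale_closed subset_iff)
    then show ?thesis using x z by (blast intro: add_closed scale_closed)
  next
    case False
    \<comment> \<open>The difference of \<open>\<Phi>\<close> and evaluation at \<open>x\<close> is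
      linear and vanishes on \<open>S\<close>.\<close>
    have "\<Phi> g - pair g x = 0"
      by (rule vanish_on_common_kernel[of S g "\<lambda>f. \<Phi> f - pair f x"])
        (use insert False g x in
          \<open>auto simp: add scale pair_vadd pair_vscale algebra_simps\<close>)
    then show ?thesis using x by auto
  qed
qed

end

section \<open>The canonical embedding and weak* limits\<close>

text \<open>\<open>S\<close> is the preimage of \<open>UNIV\<close> under any member of
  \<open>\<Phi>\<close>. For empty \<open>\<Phi>\<close> the generated topology would live on the
  empty set.\<close>

lemma topspace_initial_topology:
  assumes "\<Phi> \<noteq> {}" shows "topspace (initial_topology S \<Phi>) = S"
proof -
  obtain \<phi> where "\<phi> \<in> \<Phi>" using assms by blast
  then have "S \<in> {{x \<in> S. \<phi> x \<in> U} |\<phi> U. \<phi> \<in> \<Phi> \<and> open U}"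
    by (intro CollectI exI[of _ \<phi>] exI[of _ UNIV]) auto
  then show ?thesis unfolding initial_topology_def topology_generated_by_topspace by blast
qed

text \<open>The sets that eventually contain \<open>g x\<close> whenever they contain
  \<open>l\<close> are stable under finite intersections and arbitrary unions, so convergence can be
  tested on the generating sets.\<close>

lemma limitin_initial_topology:
  assumes "\<Phi> \<noteq> {}"
  shows "limitin (initial_topology S \<Phi>) g l F \<longleftrightarrow>
    l \<in> S \<and> (\<forall>\<^sub>F x in F. g x \<in> S) \<and> (\<forall>\<phi>\<in>\<Phi>. ((\<lambda>x. \<phi> (g x)) \<longlongrightarrow> \<phi> l) F)"
    (is "?L \<longleftrightarrow> ?R")
proof
  assume L: ?L
  have ev: "\<forall>\<^sub>F x in F. g x \<in> {x \<in> S. \<phi> x \<in> U}" if "\<phi> \<in> \<Phi>" "open U" "\<phi> l \<in> U" for \<phi> U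
  proof -
    have "openin (initial_topology S \<Phi>) {x \<in> S. \<phi> x \<in> U}"
      unfolding initial_topology_def using that
      by (intro topology_generated_by_Basis) blast
    moreover have "l \<in> S" using L assms by (auto simp: limitin_def topspace_initial_topology)
    ultimately show ?thesis using L that by (auto simp: limitin_def)
  qed
  have "\<forall>\<^sub>F x in F. g x \<in> S"
    using assms ev[of _ UNIV] by (auto elim: eventually_mono)
  moreover have "((\<lambda>x. \<phi> (g x)) \<longlongrightarrow> \<phi> l) F" if "\<phi> \<in> \<Phi>" for \<phi>
  proof (rule topological_tendstoI)
    fix U assume "open U" "\<phi> l \<in> U"
    with that have "\<forall>\<^sub>F x in F. g x \<in> {x \<in> S. \<phi> x \<in> U}" by (rule ev)
    then show "\<forall>\<^sub>F x in F. \<phi> (g x) \<in> U" by (rule eventually_mono) simp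
  qed
  ultimately show ?R
    using L assms by (auto simp: limitin_def topspace_initial_topology)
next
  assume R: ?R
  have "\<forall>\<^sub>F x in F. g x \<in> U"
    if "generate_topology_on {{x \<in> S. \<phi> x \<in> U} |\<phi> U. \<phi> \<in> \<Phi> \<and> open U} U" "l \<in> U" for U
    using that
  proof (induction rule: generate_topology_on.induct)
    case Empty
    then show ?case by simp
  next
    case (Int a b)
    then show ?case by (auto intro: eventually_conj)
  next
    case (UN K)
    then obtain k where k: "k \<in> K" "l \<in> k" by blast
    then have "\<forall>\<^sub>F x in F. g x \<in> k" using UN by blast
    then show ?case using k by (auto elim: eventually_mono)
  next
    case (Basis s)
    then obtain \<phi> U where s: "s = {x \<in> S. \<phi> x \<in> U}" "\<phi> \<in> \<Phi>" "open U" by blast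
    then have "\<forall>\<^sub>F x in F. \<phi> (g x) \<in> U"
      using R Basis by (auto dest: topological_tendstoD)
    then show ?case using R s by (auto elim: eventually_elim2)
  qed
  then show ?L
    using R assms
    by (auto simp: limitin_def topspace_initial_topology)
      (simp add: initial_topology_def openin_topology_generated_by_iff)
qed

section \<open>The bidual and the canonical map into it\<close>

locale bidual_on = coded_dual_on X c
  for X :: "('k::{real_normed_field, banach}, 'b) nspace" and c +
  fixes c' :: "('b \<Rightarrow> 'k) \<Rightarrow> 'b"
  assumes inj_c': "inj_on c' (bounded_functionals (coded_dual X c))"
begin

sublocale D: coded_dual_on X' c'
  by unfold_locales (rule inj_c')

abbreviation "X'' \<equiv> coded_dual X' c'"
abbreviation "pair' \<equiv> pairing X' c'"
abbreviation "\<iota> \<equiv> canonical_embedding X c c'"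

lemma evaluation_functional:
  assumes "x \<in> vcarrier X"
  shows "(\<lambda>f\<in>vcarrier X'. pair f x) \<in> bounded_functionals X'"
  by (rule bounded_functionalsI[where K="vnorm X x"])
    (use assms pair_bound in
      \<open>auto simp: pair_vadd pair_vscale coded.add_closed coded.scale_closed mult.commute\<close>)

lemma embedding_closed [simp]: "x \<in> vcarrier X \<Longrightarrow> \<iota> x \<in> vcarrier X''"
  unfolding canonical_embedding_def by (simp add: evaluation_functional)

lemma pair_embedding [simp]:
  "\<lbrakk>x \<in> vcarrier X; f \<in> vcarrier X'\<rbrakk> \<Longrightarrow> pair' (\<iota> x) f = pair f x"
  unfolding canonical_embedding_def by (simp add: evaluation_functional)

lemma embedding_norm_le: "x \<in> vcarrier X \<Longrightarrow> vnorm X'' (\<iota> x) \<le> vnorm X x"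
  by (rule D.coded_norm_le) (use pair_bound norm_nonneg in \<open>auto simp: mult.commute\<close>)

lemma embedding_add:
  "\<lbrakk>x \<in> vcarrier X; y \<in> vcarrier X\<rbrakk> \<Longrightarrow> \<iota> (vadd X x y) = vadd X'' (\<iota> x) (\<iota> y)"
  by (rule D.coded_eqI)
    (auto simp: add_closed D.coded.add_closed D.pair_vadd pair_add_right)

lemma embedding_scale: "x \<in> vcarrier X \<Longrightarrow> \<iota> (vscale X a x) = vscale X'' a (\<iota> x)"
  by (rule D.coded_eqI)
    (auto simp: scale_closed D.coded.scale_closed D.pair_vscale pair_scale_right)

lemma limitin_weak_star:
  "limitin (weak_star_topology X' c') g u F \<longleftrightarrow>
    u \<in> vcarrier X'' \<and> (\<forall>\<^sub>F x in F. g x \<in> vcarrier X'') \<and>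
    (\<forall>f\<in>vcarrier X'. ((\<lambda>x. pair' (g x) f) \<longlongrightarrow> pair' u f) F)"
proof -
  have "(\<lambda>x f. pair' f x) ` vcarrier X' \<noteq> {}" using coded.zero_closed by auto
  then show ?thesis by (simp add: weak_star_topology_def limitin_initial_topology)
qed

text \<open>The filter lives on the carrier, where \<open>pair' (\<iota> x) f\<close> is
  \<open>pair f x\<close>, so the embedding can be removed from the limit.\<close>

lemma limitin_embedding:
  assumes F: "F \<le> principal (vcarrier X)"
  shows "limitin (weak_star_topology X' c') \<iota> u F \<longleftrightarrow>
    u \<in> vcarrier X'' \<and> (\<forall>f\<in>vcarrier X'. (pair f \<longlongrightarrow> pair' u f) F)"
proof -
  have ev: "\<forall>\<^sub>F x in F. x \<in> vcarrier X" using F by (simp add: le_principal)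
  have "((\<lambda>x. pair' (\<iota> x) f) \<longlongrightarrow> pair' u f) F \<longleftrightarrow> (pair f \<longlongrightarrow> pair' u f) F"
    if "f \<in> vcarrier X'" for f
    by (rule tendsto_cong) (use that ev in \<open>auto elim: eventually_mono\<close>)
  moreover have "\<forall>\<^sub>F x in F. \<iota> x \<in> vcarrier X''" using ev by (auto elim: eventually_mono)
  ultimately show ?thesis by (simp add: limitin_weak_star)
qed

text \<open>Pairing with \<open>X'\<close> separates the points of \<open>X''\<close>, and limits of
  scalars along a proper filter are unique.\<close>

lemma weak_star_unique:
  assumes "limitin (weak_star_topology X' c') g u F"
    and "limitin (weak_star_topology X' c') g v F" and "F \<noteq> bot"
  shows "u = v"
  using assms by (intro D.coded_eqI) (auto simp: limitin_weak_star intro: tendsto_unique)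

text \<open>The filter is generated by the sets \<open>H f\<close> on which \<open>f\<close> takes
  exactly the value prescribed by \<open>u\<close>. Finite interpolation shows that finitely many of
  them always meet, so the filter is proper; along it each \<open>f\<close> is eventually
  constant.\<close>

lemma embedding_weak_star_dense:
  assumes u: "u \<in> vcarrier X''"
  obtains F where "F \<noteq> bot" "F \<le> principal (vcarrier X)"
    "limitin (weak_star_topology X' c') \<iota> u F"
proof
  define H where "H f = {x \<in> vcarrier X. pair f x = pair' u f}" for f
  define F where "F = (INF f\<in>vcarrier X'. principal (H f))"
  show "F \<noteq> bot"
    unfolding F_def
  proof (rule INF_filter_not_bot)
    fix S assume S: "S \<subseteq> vcarrier X'" "finite S"
    obtain x where "x \<in> vcarrier X" "\<forall>f\<in>S. pair f x = pair' u f"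
      using finite_interpolation[OF S(2,1), of "pair' u"] u
      by (auto simp: D.pair_add_right D.pair_scale_right)
    then have "(\<Inter>f\<in>S. H f) \<noteq> {}" by (auto simp: H_def)
    then show "(INF f\<in>S. principal (H f)) \<noteq> bot"
      by (simp add: INF_principal_finite[OF S(2)] principal_eq_bot_iff)
  qed
  have le: "F \<le> principal (H f)" if "f \<in> vcarrier X'" for f
    unfolding F_def using that by (rule INF_lower)
  \<comment> \<open>Any single \<open>H f\<close> lies in the carrier; the zero functional
    guarantees that there is one.\<close>
  show F: "F \<le> principal (vcarrier X)"
    using le[OF coded.zero_closed] by (rule order_trans) (auto simp: H_def)
  have "(pair f \<longlongrightarrow> pair' u f) F" if "f \<in> vcarrier X'" for f
  proof (rule tendsto_eventually)
    have "\<forall>\<^sub>F x in F. x \<in> H f" using le[OF that] by (simp add: le_principal)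
    then show "\<forall>\<^sub>F x in F. pair f x = pair' u f" by (auto simp: H_def elim: eventually_mono)
  qed
  then show "limitin (weak_star_topology X' c') \<iota> u F"
    using u by (simp add: limitin_embedding[OF F])
qed

end

section \<open>The first Arens product\<close>

text \<open>These are the properties that \<open>multiplication_arens\<close> passes on to the
  bidual, so that they can be carried through all even duals.\<close>

locale multiplication_on = prenormed_space_on X
  for X :: "('k::{real_normed_field, banach}, 'b) nspace" +
  fixes mul :: "'b \<Rightarrow> 'b \<Rightarrow> 'b"
  assumes mul_closed: "\<lbrakk>x \<in> vcarrier X; y \<in> vcarrier X\<rbrakk> \<Longrightarrow> mul x y \<in> vcarrier X"
    and mul_add_left: "\<lbrakk>x \<in> vcarrier X; y \<in> vcarrier X; z \<in> vcarrier X\<rbrakk>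
      \<Longrightarrow> mul (vadd X x y) z = vadd X (mul x z) (mul y z)"
    and mul_add_right: "\<lbrakk>x \<in> vcarrier X; y \<in> vcarrier X; z \<in> vcarrier X\<rbrakk>
      \<Longrightarrow> mul x (vadd X y z) = vadd X (mul x y) (mul x z)"
    and mul_scale_left: "\<lbrakk>x \<in> vcarrier X; y \<in> vcarrier X\<rbrakk>
      \<Longrightarrow> mul (vscale X a x) y = vscale X a (mul x y)"
    and mul_scale_right: "\<lbrakk>x \<in> vcarrier X; y \<in> vcarrier X\<rbrakk>
      \<Longrightarrow> mul x (vscale X a y) = vscale X a (mul x y)"
    and norm_mul: "\<lbrakk>x \<in> vcarrier X; y \<in> vcarrier X\<rbrakk>
      \<Longrightarrow> vnorm X (mul x y) \<le> vnorm X x * vnorm X y"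

locale bidual_algebra_on = bidual_on X c c' + multiplication_on X mul
  for X :: "('k::{real_normed_field, banach}, 'b) nspace" and c c' mul
begin

text \<open>First of the three classical stages of the Arens construction:
  \<open>dual_act f x\<close> is the right module action \<open>f . x\<close> on the dual,
  \<open>bidual_act v f\<close> is \<open>v . f\<close> in the dual, and \<open>arens u v\<close> is
  the product defined by pairing \<open>u\<close> with \<open>v . f\<close>.\<close>

definition dual_act :: "'b \<Rightarrow> 'b \<Rightarrow> 'b" where
  "dual_act f x = c (\<lambda>y\<in>vcarrier X. pair f (mul x y))"

definition bidual_act :: "'b \<Rightarrow> 'b \<Rightarrow> 'b" where
  "bidual_act v f = c (\<lambda>x\<in>vcarrier X. pair' v (dual_act f x))"

definition arens :: "'b \<Rightarrow> 'b \<Rightarrow> 'b" where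
  "arens u v = c' (\<lambda>f\<in>vcarrier X'. pair' u (bidual_act v f))"

lemma pair_mul_bound:
  assumes "f \<in> vcarrier X'" "x \<in> vcarrier X" "y \<in> vcarrier X"
  shows "norm (pair f (mul x y)) \<le> vnorm X' f * vnorm X x * vnorm X y"
proof -
  have "norm (pair f (mul x y)) \<le> vnorm X' f * vnorm X (mul x y)"
    using assms by (simp add: pair_bound mul_closed)
  also have "\<dots> \<le> vnorm X' f * (vnorm X x * vnorm X y)"
    using assms by (intro mult_left_mono norm_mul coded.norm_nonneg)
  finally show ?thesis by (simp add: mult.assoc)
qed

lemma
  assumes f: "f \<in> vcarrier X'" and x: "x \<in> vcarrier X"
  shows dual_act_closed: "dual_act f x \<in> vcarrier X'"
    and pair_dual_act: "y \<in> vcarrier X \<Longrightarrow> pair (dual_act f x) y = pair f (mul x y)"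
  unfolding dual_act_def
  by (rule code_restrict[where K="vnorm X' f * vnorm X x"];
      use f x in \<open>simp add: mul_add_right mul_scale_right pair_add_right pair_scale_right
        mul_closed pair_mul_bound\<close>)+

lemma dual_act_norm:
  "\<lbrakk>f \<in> vcarrier X'; x \<in> vcarrier X\<rbrakk> \<Longrightarrow> vnorm X' (dual_act f x) \<le> vnorm X' f * vnorm X x"
  by (rule coded_norm_le)
    (simp_all add: pair_dual_act pair_mul_bound norm_nonneg coded.norm_nonneg)

lemma dual_act_add_left:
  "\<lbrakk>f \<in> vcarrier X'; g \<in> vcarrier X'; x \<in> vcarrier X\<rbrakk>
    \<Longrightarrow> dual_act (vadd X' f g) x = vadd X' (dual_act f x) (dual_act g x)"
  by (rule coded_eqI)
    (simp_all add: dual_act_closed coded.add_closed pair_dual_act pair_vadd mul_closed)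

lemma dual_act_scale_left:
  "\<lbrakk>f \<in> vcarrier X'; x \<in> vcarrier X\<rbrakk>
    \<Longrightarrow> dual_act (vscale X' a f) x = vscale X' a (dual_act f x)"
  by (rule coded_eqI)
    (simp_all add: dual_act_closed coded.scale_closed pair_dual_act pair_vscale mul_closed)

lemma dual_act_add_right:
  "\<lbrakk>f \<in> vcarrier X'; x \<in> vcarrier X; y \<in> vcarrier X\<rbrakk>
    \<Longrightarrow> dual_act f (vadd X x y) = vadd X' (dual_act f x) (dual_act f y)"
  by (rule coded_eqI)
    (simp_all add: dual_act_closed coded.add_closed add_closed pair_dual_act pair_vadd mul_closed
      mul_add_left pair_add_right)

lemma dual_act_scale_right:
  "\<lbrakk>f \<in> vcarrier X'; x \<in> vcarrier X\<rbrakk>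
    \<Longrightarrow> dual_act f (vscale X a x) = vscale X' a (dual_act f x)"
  by (rule coded_eqI)
    (simp_all add: dual_act_closed coded.scale_closed scale_closed pair_dual_act pair_vscale
      mul_closed mul_scale_left pair_scale_right)

lemma pair'_dual_act_bound:
  assumes "v \<in> vcarrier X''" "f \<in> vcarrier X'" "x \<in> vcarrier X"
  shows "norm (pair' v (dual_act f x)) \<le> vnorm X'' v * vnorm X' f * vnorm X x"
proof -
  have "norm (pair' v (dual_act f x)) \<le> vnorm X'' v * vnorm X' (dual_act f x)"
    using assms by (simp add: D.pair_bound dual_act_closed)
  also have "\<dots> \<le> vnorm X'' v * (vnorm X' f * vnorm X x)"
    using assms by (intro mult_left_mono dual_act_norm D.coded.norm_nonneg)
  finally show ?thesis by (simp add: mult.assoc)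
qed

lemma
  assumes v: "v \<in> vcarrier X''" and f: "f \<in> vcarrier X'"
  shows bidual_act_closed: "bidual_act v f \<in> vcarrier X'"
    and pair_bidual_act: "x \<in> vcarrier X \<Longrightarrow> pair (bidual_act v f) x = pair' v (dual_act f x)"
  unfolding bidual_act_def
  by (rule code_restrict[where K="vnorm X'' v * vnorm X' f"];
      use v f in \<open>simp add: dual_act_add_right dual_act_scale_right D.pair_add_right
        D.pair_scale_right dual_act_closed pair'_dual_act_bound\<close>)+

lemma bidual_act_norm:
  "\<lbrakk>v \<in> vcarrier X''; f \<in> vcarrier X'\<rbrakk>
    \<Longrightarrow> vnorm X' (bidual_act v f) \<le> vnorm X'' v * vnorm X' f"
  by (rule coded_norm_le)
    (simp_all add: pair_bidual_act pair'_dual_act_bound D.coded.norm_nonneg coded.norm_nonneg)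

lemma bidual_act_add_left:
  "\<lbrakk>u \<in> vcarrier X''; v \<in> vcarrier X''; f \<in> vcarrier X'\<rbrakk>
    \<Longrightarrow> bidual_act (vadd X'' u v) f = vadd X' (bidual_act u f) (bidual_act v f)"
  by (rule coded_eqI)
    (simp_all add: bidual_act_closed coded.add_closed D.coded.add_closed pair_bidual_act pair_vadd
      D.pair_vadd dual_act_closed)

lemma bidual_act_scale_left:
  "\<lbrakk>v \<in> vcarrier X''; f \<in> vcarrier X'\<rbrakk>
    \<Longrightarrow> bidual_act (vscale X'' a v) f = vscale X' a (bidual_act v f)"
  by (rule coded_eqI)
    (simp_all add: bidual_act_closed coded.scale_closed D.coded.scale_closed pair_bidual_act
      pair_vscale D.pair_vscale dual_act_closed)

lemma bidual_act_add_right: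
  "\<lbrakk>v \<in> vcarrier X''; f \<in> vcarrier X'; g \<in> vcarrier X'\<rbrakk>
    \<Longrightarrow> bidual_act v (vadd X' f g) = vadd X' (bidual_act v f) (bidual_act v g)"
  by (rule coded_eqI)
    (simp_all add: bidual_act_closed coded.add_closed pair_bidual_act pair_vadd dual_act_closed
      dual_act_add_left D.pair_add_right)

lemma bidual_act_scale_right:
  "\<lbrakk>v \<in> vcarrier X''; f \<in> vcarrier X'\<rbrakk>
    \<Longrightarrow> bidual_act v (vscale X' a f) = vscale X' a (bidual_act v f)"
  by (rule coded_eqI)
    (simp_all add: bidual_act_closed coded.scale_closed pair_bidual_act pair_vscale dual_act_closed
      dual_act_scale_left D.pair_scale_right)

lemma pair'_bidual_act_bound:
  assumes "u \<in> vcarrier X''" "v \<in> vcarrier X''" "f \<in> vcarrier X'"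
  shows "norm (pair' u (bidual_act v f)) \<le> vnorm X'' u * vnorm X'' v * vnorm X' f"
proof -
  have "norm (pair' u (bidual_act v f)) \<le> vnorm X'' u * vnorm X' (bidual_act v f)"
    using assms by (simp add: D.pair_bound bidual_act_closed)
  also have "\<dots> \<le> vnorm X'' u * (vnorm X'' v * vnorm X' f)"
    using assms by (intro mult_left_mono bidual_act_norm D.coded.norm_nonneg)
  finally show ?thesis by (simp add: mult.assoc)
qed

lemma
  assumes u: "u \<in> vcarrier X''" and v: "v \<in> vcarrier X''"
  shows arens_closed: "arens u v \<in> vcarrier X''"
    and pair_arens: "f \<in> vcarrier X' \<Longrightarrow> pair' (arens u v) f = pair' u (bidual_act v f)"
  unfolding arens_def
  by (rule D.code_restrict[where K="vnorm X'' u * vnorm X'' v"];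
      use u v in \<open>simp add: bidual_act_add_right bidual_act_scale_right D.pair_add_right
        D.pair_scale_right bidual_act_closed pair'_bidual_act_bound\<close>)+

lemma multiplication_arens: "multiplication_on X'' arens"
proof
  fix u v assume "u \<in> vcarrier X''" "v \<in> vcarrier X''"
  then show "vnorm X'' (arens u v) \<le> vnorm X'' u * vnorm X'' v"
    by (intro D.coded_norm_le)
      (simp_all add: pair_arens pair'_bidual_act_bound D.coded.norm_nonneg)
qed (rule arens_closed D.coded_eqI; simp add: arens_closed pair_arens D.coded.add_closed D.coded.scale_closed
      D.pair_vadd D.pair_vscale D.pair_add_right D.pair_scale_right bidual_act_closed
      bidual_act_add_left bidual_act_scale_left)+

text \<open>Needed to restrict an inner derivation on the bidual to one on \<open>X\<close>.\<close>

lemma arens_embedding: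
  "\<lbrakk>x \<in> vcarrier X; y \<in> vcarrier X\<rbrakk> \<Longrightarrow> arens (\<iota> x) (\<iota> y) = \<iota> (mul x y)"
  by (rule D.coded_eqI)
    (simp_all add: arens_closed pair_arens bidual_act_closed pair_bidual_act dual_act_closed
      pair_dual_act mul_closed)

text \<open>Each limit is tested by an element of \<open>X'\<close>: for fixed \<open>x\<close> the
  inner one pairs \<open>y\<close> with \<open>dual_act f x\<close>, and the outer one pairs
  \<open>x\<close> with \<open>bidual_act v f\<close>.\<close>

lemma arens_iterated_limit:
  assumes F: "F \<le> principal (vcarrier X)" "limitin (weak_star_topology X' c') \<iota> u F"
    and G: "G \<le> principal (vcarrier X)" "limitin (weak_star_topology X' c') \<iota> v G"
  shows "x \<in> vcarrier X \<Longrightarrow>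
      limitin (weak_star_topology X' c') (\<lambda>y. \<iota> (mul x y)) (arens (\<iota> x) v) G"
    and "limitin (weak_star_topology X' c') (\<lambda>x. arens (\<iota> x) v) (arens u v) F"
proof -
  have u: "u \<in> vcarrier X''" "\<And>f. f \<in> vcarrier X' \<Longrightarrow> (pair f \<longlongrightarrow> pair' u f) F"
    and v: "v \<in> vcarrier X''" "\<And>f. f \<in> vcarrier X' \<Longrightarrow> (pair f \<longlongrightarrow> pair' v f) G"
    using F G by (simp_all add: limitin_embedding)
  have evF: "\<forall>\<^sub>F x in F. x \<in> vcarrier X" and evG: "\<forall>\<^sub>F x in G. x \<in> vcarrier X"
    using F G by (simp_all add: le_principal)
  show "limitin (weak_star_topology X' c') (\<lambda>y. \<iota> (mul x y)) (arens (\<iota> x) v) G"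
    if x: "x \<in> vcarrier X"
    unfolding limitin_weak_star
  proof (intro conjI ballI)
    show "arens (\<iota> x) v \<in> vcarrier X''" using x v by (simp add: arens_closed)
    show "\<forall>\<^sub>F y in G. \<iota> (mul x y) \<in> vcarrier X''"
      using evG x by (auto simp: mul_closed elim: eventually_mono)
    fix f assume f: "f \<in> vcarrier X'"
    have "(pair (dual_act f x) \<longlongrightarrow> pair' v (dual_act f x)) G"
      using v(2) f x by (simp add: dual_act_closed)
    moreover have "\<forall>\<^sub>F y in G. pair (dual_act f x) y = pair' (\<iota> (mul x y)) f"
      using evG x f by (auto simp: mul_closed pair_dual_act elim: eventually_mono)
    moreover have "pair' (arens (\<iota> x) v) f = pair' v (dual_act f x)"
      using x v f by (simp add: pair_arens bidual_act_closed pair_bidual_act)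
    ultimately show "((\<lambda>y. pair' (\<iota> (mul x y)) f) \<longlongrightarrow> pair' (arens (\<iota> x) v) f) G"
      by (simp add: filterlim_cong)
  qed
  show "limitin (weak_star_topology X' c') (\<lambda>x. arens (\<iota> x) v) (arens u v) F"
    unfolding limitin_weak_star
  proof (intro conjI ballI)
    show "arens u v \<in> vcarrier X''" using u v by (simp add: arens_closed)
    show "\<forall>\<^sub>F x in F. arens (\<iota> x) v \<in> vcarrier X''"
      using evF v by (auto simp: arens_closed elim: eventually_mono)
    fix f assume f: "f \<in> vcarrier X'"
    have "(pair (bidual_act v f) \<longlongrightarrow> pair' u (bidual_act v f)) F"
      using u(2) f v by (simp add: bidual_act_closed)
    moreover have "\<forall>\<^sub>F x in F. pair (bidual_act v f) x = pair' (arens (\<iota> x) v) f"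
      using evF v f by (auto simp: pair_arens bidual_act_closed elim: eventually_mono)
    ultimately show "((\<lambda>x. pair' (arens (\<iota> x) v) f) \<longlongrightarrow> pair' (arens u v) f) F"
      using u v f by (simp add: pair_arens filterlim_cong)
  qed
qed

text \<open>Replaces the description by iterated limits with the explicit formula. The iterated
  limits give existence for \<open>THE\<close>; uniqueness rests on density and on uniqueness of
  weak* limits.\<close>

theorem first_arens_product_eq:
  assumes u: "u \<in> vcarrier X''" and v: "v \<in> vcarrier X''"
  shows "first_arens_product X mul c c' u v = arens u v"
  unfolding first_arens_product_def Let_def
proof (rule the_equality)
  show "\<forall>F G. F \<noteq> bot \<and> F \<le> principal (vcarrier X) \<and>
      limitin (weak_star_topology X' c') \<iota> u F \<and> G \<noteq> bot \<and> G \<le> principal (vcarrier X) \<and>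
      limitin (weak_star_topology X' c') \<iota> v G \<longrightarrow>
      (\<exists>l. (\<forall>x\<in>vcarrier X. limitin (weak_star_topology X' c') (\<lambda>y. \<iota> (mul x y)) (l x) G) \<and>
        limitin (weak_star_topology X' c') l (arens u v) F)"
    using arens_iterated_limit by (intro allI impI exI[of _ "\<lambda>x. arens (\<iota> x) v"]) blast
next
  fix w
  assume w: "\<forall>F G. F \<noteq> bot \<and> F \<le> principal (vcarrier X) \<and>
      limitin (weak_star_topology X' c') \<iota> u F \<and> G \<noteq> bot \<and> G \<le> principal (vcarrier X) \<and>
      limitin (weak_star_topology X' c') \<iota> v G \<longrightarrow>
      (\<exists>l. (\<forall>x\<in>vcarrier X. limitin (weak_star_topology X' c') (\<lambda>y. \<iota> (mul x y)) (l x) G) \<and>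
        limitin (weak_star_topology X' c') l w F)"
  \<comment> \<open>Without filters converging to \<open>u\<close> and \<open>v\<close> the
    condition on \<open>w\<close> would be vacuous and would not determine it.\<close>
  obtain F where F: "F \<noteq> bot" "F \<le> principal (vcarrier X)"
      "limitin (weak_star_topology X' c') \<iota> u F"
    using embedding_weak_star_dense[OF u] .
  obtain G where G: "G \<noteq> bot" "G \<le> principal (vcarrier X)"
      "limitin (weak_star_topology X' c') \<iota> v G"
    using embedding_weak_star_dense[OF v] .
  obtain l where l: "\<And>x. x \<in> vcarrier X \<Longrightarrow>
        limitin (weak_star_topology X' c') (\<lambda>y. \<iota> (mul x y)) (l x) G"
      and lim: "limitin (weak_star_topology X' c') l w F"
    using w F G by meson
  \<comment> \<open>The inner limits are determined only on the carrier, which suffices because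
    \<open>F\<close> lives there.\<close>
  have "l x = arens (\<iota> x) v" if "x \<in> vcarrier X" for x
    using l[OF that] arens_iterated_limit(1)[OF F(2,3) G(2,3) that] G(1)
    by (rule weak_star_unique)
  then have "\<forall>\<^sub>F x in F. arens (\<iota> x) v = l x"
    using F(2) by (auto simp: le_principal elim: eventually_mono)
  then have "limitin (weak_star_topology X' c') l (arens u v) F"
    using arens_iterated_limit(2)[OF F(2,3) G(2,3)] by (rule limitin_transform_eventually)
  with lim show "w = arens u v" using F(1) by (rule weak_star_unique)
qed

lemma multiplication_first_arens: "multiplication_on X'' (first_arens_product X mul c c')"
proof -
  interpret P: multiplication_on X'' arens by (rule multiplication_arens)
  show ?thesis
    by unfold_locales
      (simp_all add: first_arens_product_eq D.coded.add_closed D.coded.scale_closed P.mul_closed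
        P.mul_add_left P.mul_add_right P.mul_scale_left P.mul_scale_right P.norm_mul)
qed

end

section \<open>The second adjoint of a derivation\<close>

text \<open>A bounded derivation into the dual with coded values. \<open>der_mul\<close> is the
  Leibniz rule evaluated at \<open>z\<close>: the right action of \<open>y\<close> multiplies
  \<open>z\<close> from the left, the left action of \<open>x\<close> from the right.\<close>

locale coded_derivation_on = bidual_algebra_on X c c' mul
  for X :: "('k::{real_normed_field, banach}, 'b) nspace" and c c' mul +
  fixes \<delta> :: "'b \<Rightarrow> 'b" and K :: real
  assumes der_closed: "x \<in> vcarrier X \<Longrightarrow> \<delta> x \<in> vcarrier X'"
    and der_add: "\<lbrakk>x \<in> vcarrier X; y \<in> vcarrier X\<rbrakk> \<Longrightarrow> \<delta> (vadd X x y) = vadd X' (\<delta> x) (\<delta> y)"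
    and der_scale: "x \<in> vcarrier X \<Longrightarrow> \<delta> (vscale X a x) = vscale X' a (\<delta> x)"
    and der_bound: "x \<in> vcarrier X \<Longrightarrow> vnorm X' (\<delta> x) \<le> K * vnorm X x"
    and bound_nonneg: "0 \<le> K"
    and der_mul: "\<lbrakk>x \<in> vcarrier X; y \<in> vcarrier X; z \<in> vcarrier X\<rbrakk>
      \<Longrightarrow> pair (\<delta> (mul x y)) z = pair (\<delta> x) (mul y z) + pair (\<delta> y) (mul z x)"
begin

text \<open>The Banach space adjoint of \<open>\<delta>\<close>, mapping \<open>X''\<close> to
  \<open>X'\<close>.\<close>

definition adjoint :: "'b \<Rightarrow> 'b" where
  "adjoint w = c (\<lambda>x\<in>vcarrier X. pair' w (\<delta> x))"

text \<open>The values are left as functionals on \<open>X''\<close>: \<open>c\<close> and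
  \<open>c'\<close> do not encode the third dual, and \<open>bounded_derivation\<close> expects
  functionals.\<close>

definition second_adjoint :: "'b \<Rightarrow> 'b \<Rightarrow> 'k" where
  "second_adjoint u = (\<lambda>w\<in>vcarrier X''. pair' u (adjoint w))"

lemma pair'_der_bound:
  assumes "w \<in> vcarrier X''" "x \<in> vcarrier X"
  shows "norm (pair' w (\<delta> x)) \<le> K * vnorm X'' w * vnorm X x"
proof -
  have "norm (pair' w (\<delta> x)) \<le> vnorm X'' w * vnorm X' (\<delta> x)"
    using assms by (simp add: D.pair_bound der_closed)
  also have "\<dots> \<le> vnorm X'' w * (K * vnorm X x)"
    using assms by (intro mult_left_mono der_bound D.coded.norm_nonneg)
  finally show ?thesis by (simp add: mult_ac)
qed

lemma
  assumes w: "w \<in> vcarrier X''"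
  shows adjoint_closed: "adjoint w \<in> vcarrier X'"
    and pair_adjoint: "x \<in> vcarrier X \<Longrightarrow> pair (adjoint w) x = pair' w (\<delta> x)"
  unfolding adjoint_def
  by (rule code_restrict[where K="K * vnorm X'' w"];
      use w in \<open>simp add: der_add der_scale der_closed D.pair_add_right D.pair_scale_right
        pair'_der_bound\<close>)+

lemma adjoint_norm: "w \<in> vcarrier X'' \<Longrightarrow> vnorm X' (adjoint w) \<le> K * vnorm X'' w"
  by (rule coded_norm_le)
    (simp_all add: pair_adjoint pair'_der_bound D.coded.norm_nonneg bound_nonneg)

lemma adjoint_add:
  "\<lbrakk>v \<in> vcarrier X''; w \<in> vcarrier X''\<rbrakk>
    \<Longrightarrow> adjoint (vadd X'' v w) = vadd X' (adjoint v) (adjoint w)"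
  by (rule coded_eqI)
    (simp_all add: adjoint_closed pair_adjoint coded.add_closed D.coded.add_closed pair_vadd
      D.pair_vadd der_closed)

lemma adjoint_scale:
  "w \<in> vcarrier X'' \<Longrightarrow> adjoint (vscale X'' a w) = vscale X' a (adjoint w)"
  by (rule coded_eqI)
    (simp_all add: adjoint_closed pair_adjoint coded.scale_closed D.coded.scale_closed pair_vscale
      D.pair_vscale der_closed)

lemma second_adjoint_apply: "w \<in> vcarrier X'' \<Longrightarrow> second_adjoint u w = pair' u (adjoint w)"
  by (simp add: second_adjoint_def)

lemma second_adjoint_bound:
  assumes "u \<in> vcarrier X''" "w \<in> vcarrier X''"
  shows "norm (second_adjoint u w) \<le> K * vnorm X'' u * vnorm X'' w"
proof -
  have "norm (pair' u (adjoint w)) \<le> vnorm X'' u * vnorm X' (adjoint w)"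
    using assms by (simp add: D.pair_bound adjoint_closed)
  also have "\<dots> \<le> vnorm X'' u * (K * vnorm X'' w)"
    using assms by (intro mult_left_mono adjoint_norm D.coded.norm_nonneg)
  finally show ?thesis using assms by (simp add: second_adjoint_apply mult_ac)
qed

lemma second_adjoint_functional:
  assumes u: "u \<in> vcarrier X''"
  shows "second_adjoint u \<in> bounded_functionals X''"
proof (rule bounded_functionalsI[where K="K * vnorm X'' u"])
  show "norm (second_adjoint u w) \<le> K * vnorm X'' u * vnorm X'' w" if "w \<in> vcarrier X''" for w
    using u that by (rule second_adjoint_bound)
qed (use u in \<open>simp_all add: second_adjoint_def D.coded.add_closed D.coded.scale_closed adjoint_add
      adjoint_scale adjoint_closed D.pair_add_right D.pair_scale_right\<close>)

lemma second_adjoint_embedding: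
  "\<lbrakk>x \<in> vcarrier X; y \<in> vcarrier X\<rbrakk> \<Longrightarrow> second_adjoint (\<iota> x) (\<iota> y) = pair (\<delta> x) y"
  by (simp add: second_adjoint_apply adjoint_closed pair_adjoint der_closed)

text \<open>The left action of \<open>x\<close> on the dual is
  \<open>bidual_act (\<iota> x)\<close>. In this form the Leibniz rule can be paired with an element
  of the bidual.\<close>

lemma der_mul_act:
  assumes "x \<in> vcarrier X" "y \<in> vcarrier X"
  shows "\<delta> (mul x y) = vadd X' (dual_act (\<delta> x) y) (bidual_act (\<iota> x) (\<delta> y))"
  by (rule coded_eqI)
    (use assms in \<open>simp_all add: der_closed mul_closed der_mul coded.add_closed dual_act_closed
      bidual_act_closed pair_vadd pair_dual_act pair_bidual_act\<close>)

text \<open>Pairing \<open>w\<close> with \<open>der_mul_act\<close> and regarding the result as a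
  functional of \<open>y\<close> gives the two summands.\<close>

lemma dual_act_adjoint:
  assumes "w \<in> vcarrier X''" "x \<in> vcarrier X"
  shows "dual_act (adjoint w) x = vadd X' (bidual_act w (\<delta> x)) (adjoint (arens w (\<iota> x)))"
  by (rule coded_eqI)
    (use assms in \<open>simp_all add: der_closed mul_closed coded.add_closed dual_act_closed
      bidual_act_closed adjoint_closed arens_closed pair_vadd pair_dual_act pair_bidual_act
      pair_adjoint pair_arens der_mul_act D.pair_add_right\<close>)

lemma pair_bidual_act_adjoint:
  assumes "v \<in> vcarrier X''" "w \<in> vcarrier X''" "x \<in> vcarrier X"
  shows "pair (bidual_act v (adjoint w)) x =
    pair (adjoint (arens v w)) x + second_adjoint v (arens w (\<iota> x))"
  using assms
  by (simp add: pair_bidual_act adjoint_closed dual_act_adjoint D.pair_add_right bidual_act_closed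
      der_closed arens_closed pair_adjoint pair_arens second_adjoint_apply)

text \<open>The identity \<open>pair_bidual_act_adjoint\<close> is taken to the limit as
  \<open>x\<close> tends to \<open>u\<close>. Two of its terms pair \<open>x\<close> with fixed
  elements of \<open>X'\<close> and converge by weak* convergence alone; the term
  \<open>second_adjoint v (arens w (\<iota> x))\<close> requires the continuity of left
  multiplication by \<open>w\<close>.\<close>

lemma second_adjoint_arens:
  assumes u: "u \<in> vcarrier X''" and v: "v \<in> vcarrier X''" and w: "w \<in> vcarrier X''"
    and cont: "continuous_map (weak_star_topology X' c') (weak_topology X'')
      (first_arens_product X mul c c' w)"
  shows "second_adjoint (arens u v) w =
    second_adjoint u (arens v w) + second_adjoint v (arens w u)"
proof -
  obtain F where F: "F \<noteq> bot" "F \<le> principal (vcarrier X)"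
      "limitin (weak_star_topology X' c') \<iota> u F"
    using embedding_weak_star_dense[OF u] .
  have ev: "\<forall>\<^sub>F x in F. x \<in> vcarrier X" using F(2) by (simp add: le_principal)
  have lim: "(pair f \<longlongrightarrow> pair' u f) F" if "f \<in> vcarrier X'" for f
    using F(3) that by (simp add: limitin_embedding[OF F(2)])
  have "limitin (weak_topology X'') (first_arens_product X mul c c' w \<circ> \<iota>)
      (first_arens_product X mul c c' w u) F"
    using cont F(3) by (rule continuous_map_limit)
  \<comment> \<open>As a bounded functional on \<open>X''\<close>, \<open>second_adjoint v\<close>
    is among the functionals that test weak convergence; it need not be weak* continuous.\<close>
  moreover have sf: "second_adjoint v \<in> bounded_functionals X''"
    using v by (rule second_adjoint_functional)
  ultimately have "((\<lambda>x. second_adjoint v (first_arens_product X mul c c' w (\<iota> x)))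
      \<longlongrightarrow> second_adjoint v (first_arens_product X mul c c' w u)) F"
    unfolding weak_topology_def
    by (subst (asm) limitin_initial_topology) auto
  moreover have "\<forall>\<^sub>F x in F. second_adjoint v (first_arens_product X mul c c' w (\<iota> x)) =
      second_adjoint v (arens w (\<iota> x))"
    using ev w by (auto simp: first_arens_product_eq elim: eventually_mono)
  ultimately have "((\<lambda>x. second_adjoint v (arens w (\<iota> x)))
      \<longlongrightarrow> second_adjoint v (arens w u)) F"
    using u w by (simp add: first_arens_product_eq filterlim_cong)
  then have "((\<lambda>x. pair (adjoint (arens v w)) x + second_adjoint v (arens w (\<iota> x)))
      \<longlongrightarrow> pair' u (adjoint (arens v w)) + second_adjoint v (arens w u)) F"
    using v w by (intro tendsto_add lim) (simp_all add: adjoint_closed arens_closed)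
  moreover have "\<forall>\<^sub>F x in F. pair (bidual_act v (adjoint w)) x =
      pair (adjoint (arens v w)) x + second_adjoint v (arens w (\<iota> x))"
    using ev v w by (auto simp: pair_bidual_act_adjoint elim: eventually_mono)
  ultimately have "(pair (bidual_act v (adjoint w))
      \<longlongrightarrow> pair' u (adjoint (arens v w)) + second_adjoint v (arens w u)) F"
    by (simp add: filterlim_cong)
  \<comment> \<open>The same scalars also converge directly, since
    \<open>bidual_act v (adjoint w)\<close> belongs to \<open>X'\<close>; comparing the two limits
    gives the identity.\<close>
  moreover have "(pair (bidual_act v (adjoint w)) \<longlongrightarrow> pair' u (bidual_act v (adjoint w))) F"
    using v w by (intro lim) (simp add: bidual_act_closed adjoint_closed)
  ultimately have "pair' u (bidual_act v (adjoint w)) =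
      pair' u (adjoint (arens v w)) + second_adjoint v (arens w u)"
    using F(1) tendsto_unique by blast
  then show ?thesis
    using u v w by (simp add: second_adjoint_apply arens_closed pair_arens adjoint_closed)
qed

text \<open>Evaluated at \<open>w\<close>, the two module actions become the two terms of
  \<open>second_adjoint_arens\<close>. As \<open>w\<close> ranges over all of \<open>X''\<close>,
  continuity is required for every left multiplication.\<close>

lemma bounded_derivation_second_adjoint:
  assumes "\<And>w. w \<in> vcarrier X'' \<Longrightarrow>
    continuous_map (weak_star_topology X' c') (weak_topology X'')
      (first_arens_product X mul c c' w)"
  shows "bounded_derivation X'' (first_arens_product X mul c c') second_adjoint"
  unfolding bounded_derivation_def Let_def vcarrier_dual
proof (intro conjI ballI allI exI)
  fix u assume u: "u \<in> vcarrier X''"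
  show "second_adjoint u \<in> bounded_functionals X''" using u by (rule second_adjoint_functional)
  show "vnorm (dual_space X'') (second_adjoint u) \<le> K * vnorm X'' u"
    using u by (intro D.coded.dual_norm_le)
      (simp_all add: second_adjoint_bound bound_nonneg D.coded.norm_nonneg)
  show "second_adjoint (vscale X'' a u) = vscale (dual_space X'') a (second_adjoint u)" for a
    using u by (auto simp: second_adjoint_def vscale_dual D.pair_vscale adjoint_closed)
  fix v assume v: "v \<in> vcarrier X''"
  show "second_adjoint (vadd X'' u v) =
      vadd (dual_space X'') (second_adjoint u) (second_adjoint v)"
    using u v by (auto simp: second_adjoint_def vadd_dual D.pair_vadd adjoint_closed)
  show "second_adjoint (first_arens_product X mul c c' u v) =
    vadd (dual_space X'')
      (right_action X'' (first_arens_product X mul c c') (second_adjoint u) v)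
      (left_action X'' (first_arens_product X mul c c') u (second_adjoint v))"
  proof (rule extensionalityI[of _ "vcarrier X''"])
    fix w assume "w \<in> vcarrier X''"
    then show "second_adjoint (first_arens_product X mul c c' u v) w =
      vadd (dual_space X'')
        (right_action X'' (first_arens_product X mul c c') (second_adjoint u) v)
        (left_action X'' (first_arens_product X mul c c') u (second_adjoint v)) w"
      using second_adjoint_arens[OF u v _ assms] u v
      by (simp add: vadd_dual right_action_def left_action_def first_arens_product_eq)
  qed (simp_all add: second_adjoint_def vadd_dual)
qed

end

section \<open>Descent of weak amenability from the bidual\<close>

theorem (in bidual_algebra_on) weakly_amenable_if_bidual:
  assumes amenable: "weakly_amenable X'' (first_arens_product X mul c c')"
    and cont: "\<And>w. w \<in> vcarrier X'' \<Longrightarrow>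
      continuous_map (weak_star_topology X' c') (weak_topology X'')
        (first_arens_product X mul c c' w)"
  shows "weakly_amenable X mul"
  unfolding weakly_amenable_def
proof (intro allI impI)
  fix D assume "bounded_derivation X mul D"
  then obtain K where
    D: "\<And>x. x \<in> vcarrier X \<Longrightarrow> D x \<in> bounded_functionals X"
      "\<And>x y. \<lbrakk>x \<in> vcarrier X; y \<in> vcarrier X\<rbrakk> \<Longrightarrow> D (vadd X x y) = vadd (dual_space X) (D x) (D y)"
      "\<And>a x. x \<in> vcarrier X \<Longrightarrow> D (vscale X a x) = vscale (dual_space X) a (D x)"
      "\<And>x. x \<in> vcarrier X \<Longrightarrow> vnorm (dual_space X) (D x) \<le> K * vnorm X x"
      "\<And>x y. \<lbrakk>x \<in> vcarrier X; y \<in> vcarrier X\<rbrakk> \<Longrightarrow>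
        D (mul x y) = vadd (dual_space X) (right_action X mul (D x) y) (left_action X mul x (D y))"
    unfolding bounded_derivation_def Let_def vcarrier_dual by blast
  \<comment> \<open>The absolute value provides the nonnegative bound; on a trivial space
    \<open>K\<close> itself could be negative.\<close>
  interpret coded_derivation_on X c c' mul "\<lambda>x. c (D x)" "\<bar>K\<bar>"
  proof
    fix x assume x: "x \<in> vcarrier X"
    have "K * vnorm X x \<le> \<bar>K\<bar> * vnorm X x"
      using norm_nonneg[OF x] by (intro mult_right_mono) auto
    then show "vnorm X' (c (D x)) \<le> \<bar>K\<bar> * vnorm X x"
      using D(1,4)[OF x] by (simp add: vnorm_coded)
    fix y z assume y: "y \<in> vcarrier X" and z: "z \<in> vcarrier X"
    have "pair (c (D (mul x y))) z = D (mul x y) z" using x y by (simp add: D(1) mul_closed)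
    then show "pair (c (D (mul x y))) z = pair (c (D x)) (mul y z) + pair (c (D y)) (mul z x)"
      using x y z by (simp add: D(1) D(5) vadd_dual right_action_def left_action_def)
  qed (simp_all add: D(1-3) vadd_coded vscale_coded)
  obtain \<phi> where \<phi>: "\<phi> \<in> bounded_functionals X''"
    and inner: "\<And>u. u \<in> vcarrier X'' \<Longrightarrow> second_adjoint u =
      vadd (dual_space X'') (left_action X'' (first_arens_product X mul c c') u \<phi>)
        (vscale (dual_space X'') (- 1) (right_action X'' (first_arens_product X mul c c') \<phi> u))"
    using amenable bounded_derivation_second_adjoint[OF cont]
    unfolding weakly_amenable_def inner_derivation_def Let_def vcarrier_dual by blast
  \<comment> \<open>The restriction of \<open>\<phi>\<close> along \<open>\<iota>\<close> is the
    candidate for implementing \<open>D\<close>.\<close>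
  define \<psi> where "\<psi> = (\<lambda>x\<in>vcarrier X. \<phi> (\<iota> x))"
  have "\<psi> \<in> bounded_functionals X"
  proof (rule bounded_functionalsI[where K="vnorm (dual_space X'') \<phi>"])
    fix x assume x: "x \<in> vcarrier X"
    have "norm (\<phi> (\<iota> x)) \<le> vnorm (dual_space X'') \<phi> * vnorm X'' (\<iota> x)"
      using \<phi> x by (simp add: D.coded.functional_bound)
    also have "\<dots> \<le> vnorm (dual_space X'') \<phi> * vnorm X x"
      using x by (intro mult_left_mono embedding_norm_le D.coded.dual_norm_nonneg \<phi>)
    finally show "norm (\<psi> x) \<le> vnorm (dual_space X'') \<phi> * vnorm X x"
      using x by (simp add: \<psi>_def)
  qed (simp_all add: \<psi>_def add_closed scale_closed embedding_add embedding_scale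
      functional_add[OF \<phi>] functional_scale[OF \<phi>])
  moreover have "D x = vadd (dual_space X) (left_action X mul x \<psi>)
      (vscale (dual_space X) (- 1) (right_action X mul \<psi> x))" if x: "x \<in> vcarrier X" for x
  proof (rule extensionalityI[of _ "vcarrier X"])
    show "D x \<in> extensional (vcarrier X)" using D(1)[OF x] by (rule functional_extensional)
    fix y assume y: "y \<in> vcarrier X"
    \<comment> \<open>The second adjoint extends \<open>D\<close>, so the formula for the inner
      derivation can be read off at embedded points.\<close>
    have "D x y = second_adjoint (\<iota> x) (\<iota> y)"
      using x y by (simp add: second_adjoint_embedding D(1))
    also have "\<dots> = \<phi> (\<iota> (mul y x)) - \<phi> (\<iota> (mul x y))"
      using x y by (simp add: inner vadd_dual vscale_dual left_action_def right_action_def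
          first_arens_product_eq arens_embedding)
    finally show "D x y = vadd (dual_space X) (left_action X mul x \<psi>)
        (vscale (dual_space X) (- 1) (right_action X mul \<psi> x)) y"
      using x y by (simp add: \<psi>_def vadd_dual vscale_dual left_action_def right_action_def
          mul_closed)
  qed (simp add: vadd_dual)
  ultimately show "inner_derivation X mul D"
    unfolding inner_derivation_def Let_def vcarrier_dual by blast
qed

section \<open>Iterated duals\<close>

lemma (in banach_algebra_on) multiplication: "multiplication_on X mul"
  by unfold_locales
    (use zero_closed norm_eq_zero in
      \<open>auto simp: add_closed scale_closed norm_nonneg norm_scale mul_closed mul_add_left
        mul_add_right mul_scale_left mul_scale_right norm_mul\<close>)

lemma bidual_algebra_iter:
  assumes "multiplication_on (iter_dual A c m) (iter_arens A mul c m)"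
    and "inj_on (c m) (bounded_functionals (iter_dual A c m))"
    and "inj_on (c (Suc m)) (bounded_functionals (iter_dual A c (Suc m)))"
  shows "bidual_algebra_on (iter_dual A c m) (c m) (c (Suc m)) (iter_arens A mul c m)"
proof -
  interpret multiplication_on "iter_dual A c m" "iter_arens A mul c m" by fact
  show ?thesis using assms(2,3) by unfold_locales simp_all
qed

text \<open>The product exists at even stages only, so the induction climbs two duals at a time,
  each step using the encodings at \<open>2 * j\<close> and \<open>Suc (2 * j)\<close>.\<close>

lemma multiplication_iter:
  assumes "multiplication_on A mul"
    and "\<And>k. k < 2 * j \<Longrightarrow> inj_on (c k) (bounded_functionals (iter_dual A c k))"
  shows "multiplication_on (iter_dual A c (2 * j)) (iter_arens A mul c (2 * j))"
  using assms(2)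
proof (induction j)
  case 0
  then show ?case using assms(1) by simp
next
  case (Suc j)
  interpret bidual_algebra_on "iter_dual A c (2 * j)" "c (2 * j)" "c (Suc (2 * j))"
      "iter_arens A mul c (2 * j)"
    using Suc.IH Suc.prems Suc.prems[of "Suc (2 * j)"]
    by (intro bidual_algebra_iter) simp_all
  show ?case using multiplication_first_arens by simp
qed

theorem theorem3p1:
  fixes A :: "('k::{real_normed_field, banach}, 'b) nspace"
    and mul :: "'b \<Rightarrow> 'b \<Rightarrow> 'b"
    and c :: "nat \<Rightarrow> ('b \<Rightarrow> 'k) \<Rightarrow> 'b"
    and n :: nat
  assumes "n \<ge> 2" and "even n"
    and "banach_algebra_on A mul"
    and "\<And>k. k < n \<Longrightarrow> inj_on (c k) (bounded_functionals (iter_dual A c k))"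
    and "Z1_tilde_left A mul c n = vcarrier (iter_dual A c n)"
    and "weakly_amenable (iter_dual A c n) (iter_arens A mul c n)"
  shows "weakly_amenable (iter_dual A c (n - 2)) (iter_arens A mul c (n - 2))"
proof -
  obtain i where "n = 2 * i" using assms(2) by (rule evenE)
  moreover from this obtain j where "i = Suc j" using assms(1) by (cases i) auto
  \<comment> \<open>In this form the recursions for \<open>iter_dual\<close> and
    \<open>iter_arens\<close> unfold: stage \<open>n\<close> is the bidual of stage
    \<open>2 * j\<close>, with the first Arens product.\<close>
  ultimately have n: "n = Suc (Suc (2 * j))" by simp
  interpret bidual_algebra_on "iter_dual A c (2 * j)" "c (2 * j)" "c (Suc (2 * j))"
      "iter_arens A mul c (2 * j)"
    using assms(4) assms(4)[of "Suc (2 * j)"] n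
    by (intro bidual_algebra_iter multiplication_iter
        banach_algebra_on.multiplication[OF assms(3)]) simp_all
  \<comment> \<open>The index \<open>n - 1\<close> in \<open>Z1_tilde_left\<close> becomes
    \<open>Suc (2 * j)\<close>, so the assumption on it is the continuity of left multiplication by
    every element of the bidual.\<close>
  have "weakly_amenable (iter_dual A c (2 * j)) (iter_arens A mul c (2 * j))"
    using assms(5,6) unfolding n Z1_tilde_left_def
    by (intro weakly_amenable_if_bidual) auto
  then show ?thesis by (simp add: n)
qed

end
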